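(* Let $\mathcal{C}$ be an $[n,K,d_{\min},\alpha,\kappa]$ vector code over $\mathbb{F}_q$ belonging to the class $\mathcal{U}$, i.e. possessing exact $(r,\delta)$ information locality with $\delta\ge2$, whose local codes $\{\mathcal{C}_i\}_{i\in\mathcal{L}}$ (with supports $\{S_i\}_{i\in\mathcal{L}}$) are uniform rank accumulation (URA) codes with common rank accumulation profile $\{a_i:1\le i\le n_L\}$, $n_L=r+\delta-1$. Let $K_L=\sum_{i=1}^{n_L}a_i$. Assume that $\mathcal{C}$ is both distance optimal and rate optimal, i.e. $d_{\min}=n-P^{(\mathrm{inv})}(K)+1$ and $K=P(n-d_{\min}+1)$. Let $u_1=\lceil K/K_L\rceil-1$. (a) If the leading-sum function $P$ is strictly sub-additive in the range $[n_L]$, then (i) the local codes all have disjoint supports, i.e. $S_i\cap S_j=\emptyset$ for all $i\neq j$ in $\mathcal{L}$; and (ii) for distinct $i_1,\dots,i_{u_1},i_{u_1+1}\in\mathcal{L}$, $$V_{i_\ell}\cap\Big(\sum_{1\le j\le u_1,\ j\ne\ell}V_{i_j}\Big)=\mathbf{0}\quad\text{for all }1\le\ell\le u_1,$$ and $$V_{i_\ell}\nsubseteq\sum_{1\le j\le u_1+1,\ j\ne\ell}V_{i_j}\quad\text{for all }1\le\ell\le u_1+1.$$ (b) If $K_L\mid K$, then (i) the local codes $\{\mathcal{C}_i\}_{i\in\mathcal{L}}$ all have disjoint supports; and (ii) for distinct $i_1,\dots,i_{u_1},i_{u_1+1}\in\mathcal{L}$, $$V_{i_\ell}\cap\Big(\sum_{1\le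 j\le u_1+1,\ j\ne\ell}V_{i_j}\Big)=\mathbf{0}\quad\text{for all }1\le\ell\le u_1+1.$$
   Context: Vector codes. An $\mathbb{F}_q$-linear vector code $\mathcal{C}$ of block length $n$ with vector-size parameter $\alpha\ge1$ is an $\mathbb{F}_q$-linear subspace of $(\mathbb{F}_q^\alpha)^n$. Its scalar dimension is $K=\dim_{\mathbb{F}_q}\mathcal{C}$. Expanding each vector symbol into $\alpha$ scalars gives a scalar code of length $n\alpha$ with $K\times n\alpha$ generator matrix $G$; the columns $(i-1)\alpha+1,\dots,i\alpha$ form the $i$-th thick column of $G$, and $W_i\subseteq\mathbb{F}_q^K$ denotes their span. Standing assumption: the $\alpha$ columns in each thick column are linearly independent. For $S\subseteq[n]$, $G|_S$ is the restriction of $G$ to the thick columns indexed by $S$, and $\mathcal{C}|_S$ is the code punctured to (restricted to) $S$. The minimum distance $d_{\min}$ is the minimum Hamming weight, counted in vector symbols, of a nonzero codeword. The quasi-dimension $\kappa$ is the minimum cardinality of a set $\mathcal{I}\subseteq[n]$ with $\mathrm{rank}(G|_{\mathcal{I}})=K$. Such a code is called an $[n,K,d_{\min},\alpha,\kappa]$ code. Exact locality. $\mathcal{C}$ has exact $(r,\delta)$ information locality if there are punctured codes $\mathcal{C}_i=\mathcal{C}|_{S_i}$, $i\in\mathcal{L}$ (the local codes), with $|S_i|=r+\delta-1$ and $d_{\min}(\mathcal{C}_i)=\delta$ for all $i\in\mathcal{L}$, and $\mathrm{Rank}(G|_{\cup_{i\in\mathcal{L}}S_i})=K$. $\mathcal{L}$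 is the index set of the local codes; distinct indices correspond to distinct local codes. For $i\in\mathcal{L}$, $V_i=\sum_{\ell\in S_i}W_\ell$ is the column space of $G|_{S_i}$. URA codes. A vector code of block length $N$ with generator matrix $G'$ is a URA code with rank accumulation profile $\{a_1,\dots,a_N\}$ (non-negative integers) if for every $i\in[N]$ and every set $S$ of $i$ thick columns, $\mathrm{rank}(G'|_S)=\sum_{j=1}^i a_j$. The functions $P$ and $P^{(\mathrm{inv})}$. Extend $(a_1,\dots,a_{n_L})$ to a periodic sequence by $a_{i+jn_L}=a_i$ for $1\le i\le n_L$, $j\ge1$. The leading-sum function is $P(s)=\sum_{i=1}^s a_i$ for $s\ge1$, $P(0)=0$. For an integer $\nu\ge1$, $P^{(\mathrm{inv})}(\nu)$ is the smallest integer $s$ with $P(s)\ge\nu$. $P$ is strictly sub-additive in the range $[n_L]$ if $P(s+s')<P(s)+P(s')$ for all $s\ge1,s'\ge1$ with $s+s'\le n_L$.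
   Formalization: The disjoint-support claims (a)(i) and (b)(i) are proved only when K > K_L (i.e. u_1 ≥ 1); for K = K_L they fail, e.g. for the length-3 repetition code with local supports {1,2} and {2,3}. *)

theory Defs
  imports "HOL-Analysis.Analysis"
begin

section \<open>Vector codes\<close>

text \<open>
  The ambient space of a vector code is the type \<open>'a ^ 'b ^ 'n\<close>: the block length is
  \<open>n = CARD('n)\<close>, the vector-size parameter is \<open>\<alpha> = CARD('b)\<close>, and \<open>'a\<close> is the finite field.
  The library only treats \<open>'a ^ 'n\<close> as an \<open>'a\<close>-vector space, so the scalar action on vectors of
  vector symbols is set up here.
\<close>

definition vscale :: "'a::field \<Rightarrow> 'a ^ 'b ^ 'n \<Rightarrow> 'a ^ 'b ^ 'n" where
  "vscale c x = (\<chi> i. c *s (x $ i))"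

global_interpretation vcode: vector_space "vscale :: 'a::field \<Rightarrow> 'a ^ 'b ^ 'n \<Rightarrow> 'a ^ 'b ^ 'n"
  by unfold_locales (simp_all add: vscale_def vec_eq_iff algebra_simps)

definition hamming_weight :: "('a::zero) ^ 'b ^ 'n \<Rightarrow> nat" where
  "hamming_weight x = card {i. x $ i \<noteq> 0}"

definition min_dist :: "(('a::zero) ^ 'b ^ 'n) set \<Rightarrow> nat" where
  "min_dist C = Min (hamming_weight ` (C - {0}))"

text \<open>
  The punctured code \<open>C|\<^sub>S\<close>, with \<open>(F\<^sub>q\<^sup>\<alpha>)\<^sup>S\<close> identified with the words that vanish outside \<open>S\<close>;
  weights, and hence minimum distances, are unaffected by this identification.
\<close>

definition puncture :: "'n set \<Rightarrow> (('a::zero) ^ 'b ^ 'n) set \<Rightarrow> ('a ^ 'b ^ 'n) set" where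
  "puncture S C = (\<lambda>x. \<chi> i. if i \<in> S then x $ i else 0) ` C"

text \<open>
  A \<open>K \<times> n\<alpha>\<close> generator matrix has type \<open>'a ^ ('n \<times> 'b) ^ 'k\<close> with \<open>K = CARD('k)\<close>; its \<open>i\<close>-th thick
  column consists of the columns with index \<open>(i, s)\<close>.
\<close>

definition encode :: "('a::field) ^ ('n::finite \<times> 'b::finite) ^ 'k::finite \<Rightarrow> 'a ^ 'k \<Rightarrow> 'a ^ 'b ^ 'n" where
  "encode G m = (\<chi> i s. (m v* G) $ (i, s))"

definition generator_matrix ::
  "('a::field) ^ ('n::finite \<times> 'b::finite) ^ 'k::finite \<Rightarrow> ('a ^ 'b ^ 'n) set \<Rightarrow> bool" where
  "generator_matrix G C \<longleftrightarrow> C = range (encode G) \<and> vcode.dim C = CARD('k)"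

definition thick_column ::
  "('a::field) ^ ('n::finite \<times> 'b::finite) ^ 'k::finite \<Rightarrow> 'n \<Rightarrow> 'b \<Rightarrow> 'a ^ 'k" where
  "thick_column G i s = column (i, s) G"

text \<open>The space \<open>W\<^sub>i\<close>.\<close>

definition thick_span ::
  "('a::field) ^ ('n::finite \<times> 'b::finite) ^ 'k::finite \<Rightarrow> 'n \<Rightarrow> ('a ^ 'k) set" where
  "thick_span G i = vec.span (range (thick_column G i))"

text \<open>\<open>rank(G|\<^sub>S)\<close>, as a column rank.\<close>

definition rank_on ::
  "('a::field) ^ ('n::finite \<times> 'b::finite) ^ 'k::finite \<Rightarrow> 'n set \<Rightarrow> nat" where
  "rank_on G S = vec.dim (\<Union>i\<in>S. range (thick_column G i))"

text \<open>
  The column space of \<open>G|\<^sub>S\<close>, as the sum of the spaces \<open>W\<^sub>i\<close>, \<open>i \<in> S\<close>. The sum is the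
  elementwise (Minkowski) sum of sets from \<open>Set_Algebras\<close>; the empty sum is \<open>{0}\<close>.
\<close>

definition col_space ::
  "('a::field) ^ ('n::finite \<times> 'b::finite) ^ 'k::finite \<Rightarrow> 'n set \<Rightarrow> ('a ^ 'k) set" where
  "col_space G S = (\<Sum>i\<in>S. thick_span G i)"

definition quasi_dim :: "('a::field) ^ ('n::finite \<times> 'b::finite) ^ 'k::finite \<Rightarrow> nat" where
  "quasi_dim G = Min (card ` {I. rank_on G I = CARD('k)})"

text \<open>
  \<open>C\<close> is an \<open>[n, K, d, \<alpha>, \<kappa>]\<close> code with generator matrix \<open>G\<close>, including the standing assumption
  that the columns in each thick column are linearly independent.
\<close>

definition vector_code ::
  "(('a::field) ^ 'b ^ 'n) set \<Rightarrow> 'a ^ ('n::finite \<times> 'b::finite) ^ 'k::finite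
    \<Rightarrow> nat \<Rightarrow> nat \<Rightarrow> nat \<Rightarrow> nat \<Rightarrow> nat \<Rightarrow> bool" where
  "vector_code C G n K d \<alpha> \<kappa> \<longleftrightarrow>
     vcode.subspace C \<and> generator_matrix G C \<and>
     (\<forall>i. inj (thick_column G i) \<and> vec.independent (range (thick_column G i))) \<and>
     n = CARD('n) \<and> K = vcode.dim C \<and> \<alpha> = CARD('b) \<and> d = min_dist C \<and> \<kappa> = quasi_dim G"

section \<open>Locality and uniform rank accumulation\<close>

text \<open>
  Local codes are identified with their supports, so that distinct indices correspond to distinct
  local codes means that \<open>S\<close> is injective on \<open>L\<close>.
\<close>

definition exact_information_locality ::
  "(('a::field) ^ 'b ^ 'n) set \<Rightarrow> 'a ^ ('n::finite \<times> 'b::finite) ^ 'k::finite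
    \<Rightarrow> nat \<Rightarrow> nat \<Rightarrow> 'l set \<Rightarrow> ('l \<Rightarrow> 'n set) \<Rightarrow> bool" where
  "exact_information_locality C G r \<delta> L S \<longleftrightarrow>
     inj_on S L \<and>
     (\<forall>i\<in>L. card (S i) = r + \<delta> - 1 \<and> min_dist (puncture (S i) C) = \<delta>) \<and>
     rank_on G (\<Union>i\<in>L. S i) = CARD('k)"

text \<open>
  The code punctured to \<open>T\<close> is a URA code with profile \<open>a\<^sub>1, \<dots>, a\<^sub>N\<close>, \<open>N = |T|\<close>. The matrix \<open>G|\<^sub>T\<close>
  spans the punctured code by rows; discarding dependent rows to obtain a generator matrix of full
  row rank does not change the rank of any set of columns.
\<close>

definition ura_on ::
  "('a::field) ^ ('n::finite \<times> 'b::finite) ^ 'k::finite \<Rightarrow> 'n set \<Rightarrow> (nat \<Rightarrow> nat) \<Rightarrow> bool" where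
  "ura_on G T a \<longleftrightarrow>
     (\<forall>i\<in>{1..card T}. \<forall>U. U \<subseteq> T \<and> card U = i \<longrightarrow> rank_on G U = (\<Sum>j=1..i. a j))"

definition class_U ::
  "(('a::field) ^ 'b ^ 'n) set \<Rightarrow> 'a ^ ('n::finite \<times> 'b::finite) ^ 'k::finite
    \<Rightarrow> nat \<Rightarrow> nat \<Rightarrow> 'l set \<Rightarrow> ('l \<Rightarrow> 'n set) \<Rightarrow> (nat \<Rightarrow> nat) \<Rightarrow> bool" where
  "class_U C G r \<delta> L S a \<longleftrightarrow>
     exact_information_locality C G r \<delta> L S \<and> \<delta> \<ge> 2 \<and> (\<forall>i\<in>L. ura_on G (S i) a)"

section \<open>The leading-sum function\<close>

text \<open>Only \<open>a 1, \<dots>, a N\<close> are used; the sequence is continued with period \<open>N\<close>.\<close>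

definition periodic_ext :: "(nat \<Rightarrow> nat) \<Rightarrow> nat \<Rightarrow> nat \<Rightarrow> nat" where
  "periodic_ext a N i = a ((i - 1) mod N + 1)"

definition leading_sum :: "(nat \<Rightarrow> nat) \<Rightarrow> nat \<Rightarrow> nat \<Rightarrow> nat" where
  "leading_sum a N s = (\<Sum>i=1..s. periodic_ext a N i)"

definition leading_sum_inv :: "(nat \<Rightarrow> nat) \<Rightarrow> nat \<Rightarrow> nat \<Rightarrow> nat" where
  "leading_sum_inv a N \<nu> = (LEAST s. leading_sum a N s \<ge> \<nu>)"

definition strictly_subadditive :: "(nat \<Rightarrow> nat) \<Rightarrow> nat \<Rightarrow> bool" where
  "strictly_subadditive P N \<longleftrightarrow>
     (\<forall>s s'. s \<ge> 1 \<and> s' \<ge> 1 \<and> s + s' \<le> N \<longrightarrow> P (s + s') < P s + P s')"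

end

(*
Let m = n - d + 1. Optimality says that P(m) = K, that P jumps at m, and that every m thick columns
have rank K. If two local codes overlap, submodularity of the rank makes the rank of their union
strictly smaller than P allows; subadditivity of P preserves this deficit while further local codes
are adjoined. At the latest when the rank reaches K, some m thick columns would have rank below
P(m) = K. Given disjoint supports, u1 local codes together with any t = m - u1 * n_L
columns of another one have rank K = u1 * K_L + P(t), which forces the u1 local codes to be in
direct sum; part (ii) follows by comparing dimensions.
*)

theory Submission
  imports Defs
begin

section \<open>The leading-sum function\<close>

lemma leading_sum_0 [simp]: "leading_sum a N 0 = 0"
  by (simp add: leading_sum_def)

lemma leading_sum_Suc: "leading_sum a N (Suc s) = leading_sum a N s + a (s mod N + 1)"
  by (simp add: leading_sum_def periodic_ext_def)

lemma leading_sum_mono: "s \<le> s' \<Longrightarrow> leading_sum a N s \<le> leading_sum a N s'"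
  by (rule lift_Suc_mono_le[of "leading_sum a N"]) (simp add: leading_sum_Suc)

lemma leading_sum_eq_sum: "s \<le> N \<Longrightarrow> leading_sum a N s = (\<Sum>i=1..s. a i)"
  by (induction s) (simp_all add: leading_sum_Suc)

lemma leading_sum_add_period: "leading_sum a N (N + s) = leading_sum a N N + leading_sum a N s"
  by (induction s) (simp_all add: leading_sum_Suc)

lemma leading_sum_add_periods:
  "leading_sum a N (q * N + s) = q * leading_sum a N N + leading_sum a N s"
proof (induction q)
  case (Suc q)
  show ?case
    using leading_sum_add_period[of a N "q * N + s"] Suc by (simp add: add.assoc)
qed simp

text \<open>The setting of a URA profile: submodularity of the rank makes it non-increasing, as
  \<open>ura_on_profile_decreasing\<close> shows later.\<close>

locale decreasing_profile =
  fixes a :: "nat \<Rightarrow> nat" and N :: nat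
  assumes N_pos: "N \<ge> 1"
    and decreasing: "\<lbrakk>1 \<le> i; i \<le> j; j \<le> N\<rbrakk> \<Longrightarrow> a j \<le> a i"
begin

abbreviation P :: "nat \<Rightarrow> nat" where "P \<equiv> leading_sum a N"

text \<open>Termwise comparison of the windows of length \<open>w\<close> that start after
  \<open>i\<close> and after \<open>j\<close>. Writing it with sums avoids truncated subtraction on
  \<open>nat\<close>.\<close>

lemma window_le:
  assumes "j \<le> i" "i + w \<le> N"
  shows "P (i + w) + P j \<le> P (j + w) + P i"
  using assms(2)
proof (induction w)
  case (Suc w)
  moreover have "a (i + w + 1) \<le> a (j + w + 1)"
    using decreasing[of "j + w + 1" "i + w + 1"] Suc.prems assms(1) by simp
  ultimately show ?case
    using assms(1) by (simp add: leading_sum_Suc)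
qed simp

text \<open>Strictness comes from the last terms of the two windows alone.\<close>

lemma window_less:
  assumes "j \<le> i" "i + w \<le> N" "1 \<le> w" "a (i + w) < a (j + w)"
  shows "P (i + w) + P j < P (j + w) + P i"
proof -
  obtain v where v: "w = Suc v"
    using assms(3) by (cases w) auto
  show ?thesis
    using window_le[of j i v] assms by (simp add: v leading_sum_Suc)
qed

lemma subadditive: "P (x + y) \<le> P x + P y"
proof -
  define s t where "s = x mod N" and "t = y mod N"
  have st: "s < N" "t < N"
    using N_pos by (simp_all add: s_def t_def)
  have xy: "x = (x div N) * N + s" "y = (y div N) * N + t"
    by (simp_all add: s_def t_def)
  have sum: "x + y = (x div N + y div N) * N + (s + t)"
    using xy by (metis add.assoc add.left_commute distrib_right)
  \<comment> \<open>Full periods contribute additively, so only residues matter. If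
    \<open>s + t\<close> exceeds \<open>N\<close>, one period is split off and the windows of length
    \<open>N - t\<close> ending at \<open>s\<close> and at \<open>N\<close> are compared.\<close>
  have "P (s + t) \<le> P s + P t"
  proof (cases "s + t \<le> N")
    case True
    then show ?thesis
      using window_le[of 0 s t] by simp
  next
    case False
    then have "P (N + (s + t - N)) = P N + P (s + t - N)"
      using leading_sum_add_period by blast
    moreover have "P N + P (s + t - N) \<le> P s + P t"
    proof -
      have "s + t - N + (N - t) = s" "t + (N - t) = N"
        using False st by auto
      then show ?thesis
        using window_le[of "s + t - N" t "N - t"] st by simp
    qed
    ultimately show ?thesis
      using False by simp
  qed
  moreover have "P x = x div N * P N + P s" "P y = y div N * P N + P t"
    using leading_sum_add_periods[of a N "x div N" s]
      leading_sum_add_periods[of a N "y div N" t] xy by simp_all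
  moreover have "P (x + y) = (x div N + y div N) * P N + P (s + t)"
    unfolding sum by (rule leading_sum_add_periods)
  ultimately show ?thesis
    by (simp add: distrib_right)
qed

end

text \<open>
  \<open>t\<close> is the residue of \<open>m = n - d + 1\<close> in \<open>{1..N}\<close>. It is a point where the leading-sum function
  jumps, whereas the function is flat just before each multiple of \<open>N\<close>.
\<close>

locale jump_profile = decreasing_profile +
  fixes t :: nat
  assumes last_zero: "a N = 0"
    and t_range: "1 \<le> t" "t \<le> N"
    and jump: "a t > 0"
    and strict_at_t: "\<lbrakk>1 \<le> c; c + t \<le> N\<rbrakk> \<Longrightarrow> P (c + t) < P c + P t"
begin

lemma t_less: "t < N"
  using t_range jump last_zero by (metis less_irrefl linorder_neqE_nat not_le)

text \<open>Periodicity reduces \<open>z\<close> to \<open>t\<close>. If \<open>c + t\<close> passes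
  the end of the period, the windows of length \<open>N - c\<close> ending at \<open>N\<close> and
  at \<open>t\<close> are compared, and \<open>a N = 0 < a t\<close> gives strictness.\<close>

lemma strictly_subadditive_at_jump:
  assumes "1 \<le> c" "c < N" "z = q * N + t"
  shows "P (c + z) < P c + P z"
proof -
  have "P (c + t) < P c + P t"
  proof (cases "c + t \<le> N")
    case True
    then show ?thesis
      using strict_at_t assms(1) by simp
  next
    case False
    then have "P (c + t) = P N + P (c + t - N)"
      using leading_sum_add_period[of a N "c + t - N"] by simp
    moreover have "P N + P (c + t - N) < P t + P c"
      using window_less[of "c + t - N" c "N - c"] False t_less assms jump last_zero by simp
    ultimately show ?thesis
      by simp
  qed
  moreover have "P (c + z) = q * P N + P (c + t)" "P z = q * P N + P t"
    using leading_sum_add_periods[of a N q "c + t"] leading_sum_add_periods[of a N q t] assms(3)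
    by (simp_all add: add.left_commute)
  ultimately show ?thesis
    by simp
qed

end

section \<open>Families of local codes meeting both bounds\<close>

text \<open>Here \<open>f\<close> is the rank function and \<open>u * N + t = n - d + 1\<close>.\<close>

locale optimal_family = jump_profile a N t
  for a :: "nat \<Rightarrow> nat" and N t +
  fixes f :: "'n::finite set \<Rightarrow> nat" and L :: "'l set" and S :: "'l \<Rightarrow> 'n set" and u :: nat
  assumes submodular: "f (A \<union> B) + f (A \<inter> B) \<le> f A + f B"
    and inj: "inj_on S L"
    and card_S: "l \<in> L \<Longrightarrow> card (S l) = N"
    and ura: "\<lbrakk>l \<in> L; U \<subseteq> S l\<rbrakk> \<Longrightarrow> f U = P (card U)"
    and full: "u * N + t \<le> card U \<Longrightarrow> f U = P (u * N + t)"
    and full_L: "f (\<Union>l\<in>L. S l) = P (u * N + t)"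
begin

abbreviation m :: nat where "m \<equiv> u * N + t"

lemma P_m: "P m = u * P N + P t"
  by (rule leading_sum_add_periods)

text \<open>Submodularity is applied to \<open>T\<close> and
  \<open>S l \<inter> T \<union> U\<close>. The latter lies in one local code, so \<open>ura\<close>
  gives its rank and that of the intersection \<open>S l \<inter> T\<close>.\<close>

lemma f_extend_le:
  assumes "l \<in> L" "U \<subseteq> S l - T"
  shows "f (T \<union> U) + P (card (S l \<inter> T)) \<le> f T + P (card (S l \<inter> T) + card U)"
proof -
  have "T \<union> (S l \<inter> T \<union> U) = T \<union> U" "T \<inter> (S l \<inter> T \<union> U) = S l \<inter> T"
    using assms(2) by auto
  moreover have "f (S l \<inter> T \<union> U) = P (card (S l \<inter> T) + card U)"
    using ura[of l "S l \<inter> T \<union> U"] assms card_Un_disjoint[of "S l \<inter> T" U] by fastforce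
  moreover have "f (S l \<inter> T) = P (card (S l \<inter> T))"
    using ura assms(1) by simp
  ultimately show ?thesis
    using submodular[of T "S l \<inter> T \<union> U"] by simp
qed

lemma f_extend_le_P:
  assumes "l \<in> L" "U \<subseteq> S l - T"
  shows "f (T \<union> U) \<le> f T + P (card U)"
  using f_extend_le[OF assms] subadditive[of "card (S l \<inter> T)" "card U"] by linarith

lemma f_union_le:
  assumes "l \<in> L"
  shows "f (T \<union> S l) + P (card (S l \<inter> T)) \<le> f T + P N"
proof -
  have "card (S l \<inter> T) + card (S l - T) = N"
    using card_S[OF assms] card_Un_disjoint[of "S l \<inter> T" "S l - T"] by (simp add: Int_Diff_disjoint Int_Diff_Un)
  then show ?thesis
    using f_extend_le[OF assms, of "S l - T" T] by simp
qed

lemma card_union: "l \<in> L \<Longrightarrow> card (T \<union> S l) + card (S l \<inter> T) = card T + N"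
  using card_Un_Int[of T "S l"] card_S by (simp add: Int_commute)

text \<open>
  In a deficient set the rank falls short of what the leading-sum function allows, at every size
  that is congruent to \<open>m\<close>.
\<close>

definition deficient :: "'n set \<Rightarrow> bool" where
  "deficient T \<longleftrightarrow> card T < m \<and> (\<forall>z q. card T + z = q * N + t \<longrightarrow> f T + P z < P (card T + z))"

text \<open>The size stays below \<open>m\<close>, since otherwise some columns of
  \<open>S l\<close> would complete \<open>T\<close> to \<open>m\<close> columns of rank below
  \<open>P m\<close>, against \<open>full\<close>. The gap survives because \<open>S l\<close> adds
  at most \<open>P N - P c\<close> to the rank, where \<open>c\<close> is the size of the
  overlap.\<close>

lemma deficient_union:
  assumes "deficient T" "l \<in> L"
  shows "deficient (T \<union> S l)"
proof -
  define c where "c = card (S l \<inter> T)"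
  have c: "c \<le> N"
    using card_S[OF assms(2)] card_mono[of "S l" "S l \<inter> T"] by (simp add: c_def)
  have card: "card (T \<union> S l) + c = card T + N"
    using card_union[OF assms(2)] by (simp add: c_def)
  have gap: "f T + P z < P (card T + z)" if "card T + z = q * N + t" for z q
    using assms(1) that unfolding deficient_def by blast
  have "card (T \<union> S l) < m"
  proof (rule ccontr)
    assume "\<not> ?thesis"
    moreover have "card (T \<union> S l) = card T + card (S l - T)"
      using card_Un_disjoint[of T "S l - T"] by simp
    ultimately have "m - card T \<le> card (S l - T)"
      by simp
    then obtain U where U: "U \<subseteq> S l - T" "card U = m - card T"
      by (meson obtain_subset_with_card_n)
    have T: "card T < m"
      using assms(1) by (simp add: deficient_def)
    have "card (T \<union> U) = m"
      using card_Un_disjoint[of T U] U T by fastforce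
    then have "f (T \<union> U) = P m"
      using full by simp
    moreover have "f (T \<union> U) \<le> f T + P (m - card T)"
      using f_extend_le_P[OF assms(2) U(1)] U(2) by simp
    moreover have "f T + P (m - card T) < P m"
      using gap[of "m - card T" u] T by simp
    ultimately show False
      by simp
  qed
  moreover have "f (T \<union> S l) + P z < P (card (T \<union> S l) + z)"
    if z: "card (T \<union> S l) + z = q * N + t" for z q
  proof -
    \<comment> \<open>\<open>S l\<close> contributes \<open>N - c\<close> new columns, so the gap of
      \<open>T\<close> is read off at \<open>N - c + z\<close>: the total size, and with it the
      residue, is unchanged.\<close>
    have eq: "card T + (N - c + z) = card (T \<union> S l) + z"
      using card c by simp
    have "P N + P z = P (c + (N - c + z))"
      using leading_sum_add_period[of a N z] c by simp
    also have "\<dots> \<le> P c + P (N - c + z)"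
      by (rule subadditive)
    finally have "P N + P z \<le> P c + P (N - c + z)" .
    moreover have "f (T \<union> S l) + P c \<le> f T + P N"
      using f_union_le[OF assms(2)] by (simp add: c_def)
    moreover have "f T + P (N - c + z) < P (card (T \<union> S l) + z)"
      using gap[of "N - c + z" q] eq z by simp
    ultimately show ?thesis
      by linarith
  qed
  ultimately show ?thesis
    by (simp add: deficient_def)
qed

lemma card_Int_less:
  assumes "i \<in> L" "j \<in> L" "i \<noteq> j"
  shows "card (S j \<inter> S i) < N"
proof -
  have "\<not> S j \<subseteq> S i"
  proof
    assume "S j \<subseteq> S i"
    moreover have "card (S j) = card (S i)"
      using card_S[OF assms(1)] card_S[OF assms(2)] by simp
    ultimately have "S j = S i"
      by (intro card_subset_eq) simp_all
    then show False
      using inj_onD[OF inj] assms by blast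
  qed
  then have "S j \<inter> S i \<subset> S j"
    by blast
  then show ?thesis
    using psubset_card_mono[of "S j"] card_S[OF assms(2)] by simp
qed

text \<open>The start of the induction. The rank is at most \<open>2 * P N - P c\<close> for an
  overlap of size \<open>c\<close>, and strict subadditivity at sizes congruent to \<open>m\<close>
  turns this into a gap. This is why \<open>deficient\<close> only looks at such sizes.\<close>

lemma deficient_overlap:
  assumes "i \<in> L" "j \<in> L" "i \<noteq> j" "S i \<inter> S j \<noteq> {}" "1 \<le> u"
  shows "deficient (S i \<union> S j)"
proof -
  define c where "c = card (S j \<inter> S i)"
  have c: "1 \<le> c" "c < N"
    using assms(4) card_Int_less[OF assms(1-3)] by (simp_all add: c_def Suc_le_eq card_gt_0_iff Int_commute)
  have card: "card (S i \<union> S j) + c = 2 * N"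
    using card_union[OF assms(2), of "S i"] card_S[OF assms(1)] by (simp add: c_def)
  have fSi: "f (S i) = P N"
    using ura[OF assms(1), of "S i"] card_S[OF assms(1)] by simp
  have N_less: "N < m"
    using assms(5) t_range by (cases u) auto
  have "card (S i \<union> S j) < m"
  proof (rule ccontr)
    assume "\<not> ?thesis"
    moreover have "card (S i \<union> S j) = N + card (S j - S i)"
      using card_Un_disjoint[of "S i" "S j - S i"] card_S[OF assms(1)] by simp
    ultimately have "m - N \<le> card (S j - S i)"
      by simp
    then obtain U where U: "U \<subseteq> S j - S i" "card U = m - N"
      by (meson obtain_subset_with_card_n)
    have "card (S i \<union> U) = m"
      using card_Un_disjoint[of "S i" U] U card_S[OF assms(1)] N_less by fastforce
    then have "f (S i \<union> U) = P m"
      using full by simp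
    moreover have "f (S i \<union> U) + P c \<le> P N + P (c + (m - N))"
      using f_extend_le[OF assms(2) U(1)] U(2) fSi by (simp add: c_def)
    moreover have "P m = P N + P (m - N)"
      using leading_sum_add_period[of a N "m - N"] N_less by simp
    \<comment> \<open>Since \<open>1 \<le> u\<close>, removing one period leaves a size that is
      still congruent to \<open>m\<close>.\<close>
    moreover have "m - N = (u - 1) * N + t"
      using assms(5) by (cases u) auto
    then have "P (c + (m - N)) < P c + P (m - N)"
      by (rule strictly_subadditive_at_jump[OF c])
    ultimately show False
      by simp
  qed
  moreover have "f (S i \<union> S j) + P z < P (card (S i \<union> S j) + z)"
    if z: "card (S i \<union> S j) + z = q * N + t" for z q
  proof -
    have "P (c + (q * N + t)) < P c + P (q * N + t)"
      using strictly_subadditive_at_jump[OF c] by blast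
    moreover have "c + (q * N + t) = 2 * N + z"
      using z card by simp
    then have "P (c + (q * N + t)) = 2 * P N + P z"
      using leading_sum_add_periods[of a N 2 z] by simp
    moreover have "f (S i \<union> S j) + P c \<le> P N + P N"
      using f_union_le[OF assms(2), of "S i"] fSi by (simp add: c_def)
    ultimately show ?thesis
      using z by simp
  qed
  ultimately show ?thesis
    by (simp add: deficient_def)
qed

lemma finite_L: "finite L"
  by (rule finite_imageD[OF finite inj])

text \<open>An overlap would make the union of all local codes deficient. At total size
  \<open>m\<close> the gap puts its rank strictly below \<open>P m\<close>, against
  \<open>full_L\<close>.\<close>

lemma disjoint_supports:
  assumes "1 \<le> u" "i \<in> L" "j \<in> L" "i \<noteq> j"
  shows "S i \<inter> S j = {}"
proof (rule ccontr)
  assume "S i \<inter> S j \<noteq> {}"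
  then have base: "deficient (S i \<union> S j)"
    using deficient_overlap assms by simp
  have "deficient (S i \<union> S j \<union> (\<Union>l\<in>J. S l))" if "J \<subseteq> L" for J
    using finite_subset[OF that finite_L] that
  proof (induction rule: finite_induct)
    case (insert l J)
    then have "deficient ((S i \<union> S j \<union> (\<Union>l\<in>J. S l)) \<union> S l)"
      using deficient_union by simp
    then show ?case
      by (simp add: Un_ac)
  qed (simp add: base)
  moreover have "S i \<union> S j \<union> (\<Union>l\<in>L. S l) = (\<Union>l\<in>L. S l)"
    using assms by auto
  ultimately have def: "deficient (\<Union>l\<in>L. S l)"
    by (metis order_refl)
  then have "card (\<Union>l\<in>L. S l) + (m - card (\<Union>l\<in>L. S l)) = m"
    by (simp add: deficient_def)
  with def have "f (\<Union>l\<in>L. S l) + P (m - card (\<Union>l\<in>L. S l)) < P m"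
    unfolding deficient_def by metis
  then show False
    using full_L by simp
qed

section \<open>Ranks of unions of \<open>u + 1\<close> local codes with members removed\<close>

lemma P_t_pos: "0 < P t"
proof -
  obtain s where s: "t = Suc s"
    using t_range by (cases t) auto
  then show ?thesis
    using jump t_less by (simp add: leading_sum_Suc)
qed

lemma f_Union_le:
  assumes "L \<noteq> {}" "J \<subseteq> L"
  shows "f (\<Union>l\<in>J. S l) \<le> card J * P N"
  using finite_subset[OF assms(2) finite_L] assms(2)
proof (induction rule: finite_induct)
  case empty
  \<comment> \<open>\<open>f {} = 0\<close> follows from \<open>ura\<close> at any member of
    \<open>L\<close>.\<close>
  then show ?case
    using ura[of _ "{}"] assms(1) by fastforce
next
  case (insert l J)
  then have "f ((\<Union>l\<in>J. S l) \<union> S l) \<le> f (\<Union>l\<in>J. S l) + P N"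
    using f_union_le[of l "\<Union>l\<in>J. S l"] by simp
  then show ?case
    using insert by (simp add: Un_commute)
qed

lemma card_Union:
  assumes "J \<subseteq> L" "card J \<le> u + 1"
  shows "card (\<Union>l\<in>J. S l) = card J * N"
proof -
  have fin: "finite J"
    by (rule finite_subset[OF assms(1) finite_L])
  have "S i \<inter> S j = {}" if "i \<in> J" "j \<in> J" "i \<noteq> j" for i j
  proof -
    \<comment> \<open>Two distinct members of \<open>J\<close> force \<open>1 \<le> u\<close>, so
      \<open>disjoint_supports\<close> applies; for \<open>u = 0\<close> there is no such
      pair.\<close>
    have "card {i, j} \<le> card J"
      using that fin by (intro card_mono) auto
    then show ?thesis
      using that assms disjoint_supports[of i j] by auto
  qed
  then show ?thesis
    using card_UN_disjoint[OF fin, of S] assms(1) card_S by (simp add: subset_eq)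
qed

lemma f_Union_full:
  assumes "J \<subseteq> L" "card J = u + 1"
  shows "f (\<Union>l\<in>J. S l) = P m"
  using full[of "\<Union>l\<in>J. S l"] card_Union[OF assms(1)] assms(2) t_range by simp

text \<open>The \<open>u\<close> remaining codes and \<open>t\<close> columns of the removed one
  make \<open>m\<close> columns of rank \<open>u * P N + P t\<close>. Those \<open>t\<close> columns
  account for at most \<open>P t\<close>, so the upper bound \<open>u * P N\<close> is
  attained.\<close>

lemma f_Union_remove_eq:
  assumes J: "J \<subseteq> L" "card J = u + 1" and l: "l \<in> J"
  shows "f (\<Union>j\<in>J - {l}. S j) = u * P N"
proof -
  define T where "T = (\<Union>j\<in>J - {l}. S j)"
  have fin: "finite J"
    by (rule finite_subset[OF J(1) finite_L])
  have cJ: "card (J - {l}) = u"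
    using J(2) l fin by simp
  have T: "card T = u * N"
    using card_Union[of "J - {l}"] J(1) cJ by (auto simp: T_def)
  have "T \<union> S l = (\<Union>j\<in>J. S j)"
    using l by (auto simp: T_def)
  then have "card (T \<union> S l) = (u + 1) * N"
    using card_Union[OF J(1)] J(2) by simp
  moreover have "card (T \<union> S l) = card T + card (S l - T)"
    using card_Un_disjoint[of T "S l - T"] by simp
  ultimately have "t \<le> card (S l - T)"
    using T t_range by simp
  then obtain U where U: "U \<subseteq> S l - T" "card U = t"
    by (meson obtain_subset_with_card_n)
  have "card (T \<union> U) = m"
    using card_Un_disjoint[of T U] U T by fastforce
  then have "f (T \<union> U) = P m"
    using full by simp
  moreover have "f (T \<union> U) \<le> f T + P t"
    using f_extend_le_P[of l U T] J(1) l U by auto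
  moreover have "f T \<le> u * P N"
    using f_Union_le[of "J - {l}"] J(1) l cJ by (auto simp: T_def)
  ultimately show ?thesis
    using P_m by (simp add: T_def)
qed

lemma Union_insert_removed: "l \<in> J \<Longrightarrow> S l \<union> (\<Union>j\<in>J - {l}. S j) = (\<Union>j\<in>J. S j)"
  by auto

lemma f_Union_remove_less:
  assumes "J \<subseteq> L" "card J = u + 1" "l \<in> J"
  shows "f (\<Union>j\<in>J - {l}. S j) < f (S l \<union> (\<Union>j\<in>J - {l}. S j))"
  using f_Union_remove_eq[OF assms] f_Union_full[OF assms(1,2)] P_m P_t_pos
  by (simp add: Union_insert_removed[OF assms(3)])

lemma f_Union_remove_additive:
  assumes "J \<subseteq> L" "card J = u + 1" "l \<in> J" "P t = P N"
  shows "f (S l) + f (\<Union>j\<in>J - {l}. S j) \<le> f (S l \<union> (\<Union>j\<in>J - {l}. S j))"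
proof -
  have "l \<in> L"
    using assms(1,3) by auto
  then have "f (S l) = P N"
    using ura[of l "S l"] card_S[of l] by simp
  then show ?thesis
    using f_Union_remove_eq[OF assms(1-3)] f_Union_full[OF assms(1,2)] P_m assms(4)
    by (simp add: Union_insert_removed[OF assms(3)])
qed

text \<open>The \<open>u\<close> codes left after removing \<open>l\<close> have rank exactly
  \<open>u * P N\<close>. Of this, \<open>S i\<close> has \<open>P N\<close> and the other
  \<open>u - 1\<close> codes have at most \<open>(u - 1) * P N\<close>.\<close>

lemma f_Union_remove2_additive:
  assumes J: "J \<subseteq> L" "card J = u + 1" and l: "l \<in> J" "i \<in> J" "i \<noteq> l"
  shows "f (S i) + f (\<Union>j\<in>J - {l} - {i}. S j) \<le> f (S i \<union> (\<Union>j\<in>J - {l} - {i}. S j))"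
proof -
  have fin: "finite J"
    by (rule finite_subset[OF J(1) finite_L])
  have u: "card (J - {l} - {i}) + 1 = u"
    using J(2) l fin card_Suc_Diff1[of "J - {l}" i] by simp
  have "u * P N = card (J - {l} - {i}) * P N + P N"
    by (simp flip: u)
  moreover have "f (\<Union>j\<in>J - {l} - {i}. S j) \<le> card (J - {l} - {i}) * P N"
    using f_Union_le[of "J - {l} - {i}"] J(1) l by auto
  moreover have "f (S i) = P N"
    using ura[of i "S i"] card_S[of i] J(1) l by (simp add: subsetD)
  ultimately show ?thesis
    using f_Union_remove_eq[OF J l(1)] Union_insert_removed[of i "J - {l}"] l by simp
qed

end

section \<open>Rank of thick columns\<close>

abbreviation columns_on ::
  "('a::field) ^ ('n::finite \<times> 'b::finite) ^ 'k::finite \<Rightarrow> 'n set \<Rightarrow> ('a ^ 'k) set" where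
  "columns_on G U \<equiv> (\<Union>i\<in>U. range (thick_column G i))"

lemma vec_span_Un_plus: "vec.span (A \<union> B) = vec.span A + vec.span B"
  by (auto simp: vec.span_Un set_plus_def)

lemma vec_dim_Un_Int:
  "vec.dim (A \<union> B) + vec.dim (vec.span A \<inter> vec.span B) = vec.dim A + vec.dim B"
proof -
  have "vec.dim (vec.span (A \<union> B)) + vec.dim (vec.span A \<inter> vec.span B)
      = vec.dim (vec.span A) + vec.dim (vec.span B)"
    unfolding vec.span_Un
    using vec.dim_sums_Int[of "vec.span A" "vec.span B"] by (simp add: vec.subspace_span)
  then show ?thesis
    by simp
qed

lemma rank_on_submodular: "rank_on G (A \<union> B) + rank_on G (A \<inter> B) \<le> rank_on G A + rank_on G B"
proof -
  have "columns_on G (A \<inter> B) \<subseteq> vec.span (columns_on G A) \<inter> vec.span (columns_on G B)"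
    by (auto intro: vec.span_base)
  then have "rank_on G (A \<inter> B)
      \<le> vec.dim (vec.span (columns_on G A) \<inter> vec.span (columns_on G B))"
    unfolding rank_on_def by (rule vec.dim_subset)
  then show ?thesis
    using vec_dim_Un_Int[of "columns_on G A" "columns_on G B"] by (simp add: rank_on_def UN_Un)
qed

lemma rank_on_mono: "A \<subseteq> B \<Longrightarrow> rank_on G A \<le> rank_on G B"
  unfolding rank_on_def by (intro vec.dim_subset) auto

section \<open>Translation of rank statements into statements on column spaces\<close>

lemma span_sum_vec_span:
  "finite J \<Longrightarrow> (\<Sum>j\<in>J. vec.span (A j)) = vec.span (\<Union>j\<in>J. A j)"
  by (induction rule: finite_induct) (simp_all add: vec_span_Un_plus)

lemma col_space_eq_span: "col_space G U = vec.span (columns_on G U)"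
  by (simp add: col_space_def thick_span_def span_sum_vec_span)

lemma sum_col_space: "finite J \<Longrightarrow> (\<Sum>j\<in>J. col_space G (S j)) = col_space G (\<Union>j\<in>J. S j)"
  by (simp add: col_space_eq_span span_sum_vec_span)

lemma col_space_Int_trivial:
  assumes "rank_on G A + rank_on G B \<le> rank_on G (A \<union> B)"
  shows "col_space G A \<inter> col_space G B = {0}"
proof -
  have "vec.dim (col_space G A \<inter> col_space G B) = 0"
    using vec_dim_Un_Int[of "columns_on G A" "columns_on G B"] assms
    by (simp add: rank_on_def UN_Un col_space_eq_span del: vec.dim_eq_0)
  then show ?thesis
    by (auto simp: col_space_eq_span vec.span_zero)
qed

lemma col_space_not_subset:
  assumes "rank_on G B < rank_on G (A \<union> B)"
  shows "\<not> col_space G A \<subseteq> col_space G B"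
proof
  assume "col_space G A \<subseteq> col_space G B"
  then have "columns_on G (A \<union> B) \<subseteq> col_space G B"
    using vec.span_superset[of "columns_on G A"] vec.span_superset[of "columns_on G B"]
    unfolding col_space_eq_span UN_Un by blast
  then show False
    using vec.dim_subset[of "columns_on G (A \<union> B)" "col_space G B"] assms
    by (simp add: rank_on_def col_space_eq_span)
qed

section \<open>Minimum distance and rank\<close>

lemma annihilator_not_span:
  fixes v :: "('a::field) ^ 'k::finite"
  assumes "v \<notin> vec.span A"
  obtains x :: "'a ^ 'k" where "\<And>y. y \<in> A \<Longrightarrow> (\<Sum>i\<in>UNIV. x $ i * y $ i) = 0"
    "(\<Sum>i\<in>UNIV. x $ i * v $ i) \<noteq> 0"
proof -
  obtain B where B: "B \<subseteq> A" "vec.independent B" "A \<subseteq> vec.span B"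
    by (rule vec.maximal_independent_subset)
  have v: "v \<notin> vec.span B"
    using assms vec.span_mono[OF B(1)] by blast
  then have "vec.independent (insert v B)"
    using B(2) by (simp add: vec.independent_insert)
  \<comment> \<open>\<open>g\<close> kills a basis of the span of \<open>A\<close> and fixes
    \<open>v\<close>. The row of its matrix at a coordinate where \<open>v\<close> is nonzero is the
    required functional.\<close>
  then obtain g where g: "Vector_Spaces.linear (*s) (*s) g"
    "\<forall>y\<in>insert v B. g y = (if y = v then v else 0)"
    using vec.linear_independent_extend[of "insert v B" "\<lambda>y. if y = v then v else 0"] by blast
  have gv: "g v = v" and gB: "\<And>y. y \<in> B \<Longrightarrow> g y = 0"
    using g(2) v vec.span_base by auto
  have gA: "g y = 0" if "y \<in> A" for y
    using vec.linear_eq_0_on_span[OF g(1) gB] B(3) that by blast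
  have g_row: "g y $ i = (\<Sum>j\<in>UNIV. matrix g $ i $ j * y $ j)" for y i
    using matrix_works[OF g(1), of y, symmetric] by (simp add: matrix_vector_mult_def)
  have "v \<noteq> 0"
    using assms by (auto simp: vec.span_zero)
  then obtain i where "v $ i \<noteq> 0"
    by (auto simp: vec_eq_iff)
  then show ?thesis
    using that[of "matrix g $ i"] gA gv by (simp flip: g_row)
qed

lemma encode_nth:
  "encode G x $ i $ s = (\<Sum>j\<in>UNIV. x $ j * thick_column G i s $ j)"
  by (simp add: encode_def vector_matrix_mult_def thick_column_def column_def)

text \<open>If the rank dropped, some message would annihilate all columns on \<open>U\<close> but
  not all on \<open>T\<close>. Its punctured codeword would be nonzero and supported in
  \<open>T - U\<close>, so of too small a weight. The lemma serves both the whole code and the local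
  codes.\<close>

lemma rank_on_eq_if_min_dist_puncture:
  fixes C :: "(('a::field) ^ 'b::finite ^ 'n::finite) set"
    and G :: "'a ^ ('n \<times> 'b) ^ 'k::finite"
  assumes C: "C = range (encode G)"
    and d: "card (T - U) < min_dist (puncture T C)" and U: "U \<subseteq> T"
  shows "rank_on G U = rank_on G T"
proof (rule ccontr)
  assume neq: "rank_on G U \<noteq> rank_on G T"
  have "\<not> columns_on G T \<subseteq> vec.span (columns_on G U)"
  proof
    assume "columns_on G T \<subseteq> vec.span (columns_on G U)"
    then have "rank_on G T \<le> rank_on G U"
      unfolding rank_on_def by (metis vec.dim_span vec.dim_subset)
    then show False
      using neq rank_on_mono[OF U, of G] by simp
  qed
  then obtain i s where i: "i \<in> T" and notin: "thick_column G i s \<notin> vec.span (columns_on G U)"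
    by auto
  obtain x where x: "\<And>y. y \<in> columns_on G U \<Longrightarrow> (\<Sum>j\<in>UNIV. x $ j * y $ j) = 0"
    "(\<Sum>j\<in>UNIV. x $ j * thick_column G i s $ j) \<noteq> 0"
    using annihilator_not_span[OF notin] by blast
  define w where "w = (\<chi> i. if i \<in> T then encode G x $ i else 0)"
  have "encode G x $ j = 0" if "j \<in> U" for j
    using that x(1) by (auto simp: vec_eq_iff encode_nth)
  then have "{j. w $ j \<noteq> 0} \<subseteq> T - U"
    by (auto simp: w_def)
  then have "hamming_weight w \<le> card (T - U)"
    unfolding hamming_weight_def by (intro card_mono) auto
  moreover have "w \<in> puncture T C - {0}"
    using i x(2) by (auto simp: w_def puncture_def C encode_nth vec_eq_iff)
  moreover have "finite (hamming_weight ` (puncture T C - {0}))"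
    by (rule finite_subset[of _ "{..CARD('n)}"]) (auto simp: hamming_weight_def card_mono)
  ultimately show False
    using d Min_le[of "hamming_weight ` (puncture T C - {0})" "hamming_weight w"]
    by (fastforce simp: min_dist_def)
qed

lemma puncture_UNIV [simp]: "puncture UNIV C = C"
  by (simp add: puncture_def)

lemma rank_on_empty [simp]: "rank_on G {} = 0"
  by (simp add: rank_on_def)

lemma rank_on_le_CARD:
  fixes G :: "('a::field) ^ ('n::finite \<times> 'b::finite) ^ 'k::finite"
  shows "rank_on G U \<le> CARD('k)"
  unfolding rank_on_def by (metis vec.dim_subset subset_UNIV vec_dim_card)

section \<open>Profiles of URA codes\<close>

lemma ura_on_rank:
  assumes "ura_on G T a" "U \<subseteq> T"
  shows "rank_on G U = leading_sum a (card T) (card U)"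
proof (cases "U = {}")
  case False
  have "card U \<le> card T"
    using assms(2) by (intro card_mono) simp_all
  moreover have "card U \<ge> 1"
    using False by (simp add: Suc_le_eq card_gt_0_iff)
  ultimately show ?thesis
    using assms by (simp add: ura_on_def leading_sum_eq_sum)
qed simp

text \<open>Submodularity for two sets of size \<open>j\<close> that share a subset \<open>A\<close>
  of size \<open>j - 1\<close>: the second added column gains no more rank than the first.\<close>

lemma ura_on_profile_step:
  assumes ura: "ura_on G T a" and j: "1 \<le> j" "j < card T"
  shows "a (Suc j) \<le> a j"
proof -
  obtain i where i: "j = Suc i"
    using j(1) by (cases j) auto
  obtain A where A: "A \<subseteq> T" "card A = i"
    using obtain_subset_with_card_n[of i T] i j(2) by auto
  then have "card (T - A) \<ge> 2"
    using i j(2) by (simp add: card_Diff_subset)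
  then obtain B where B: "B \<subseteq> T - A" "card B = 2"
    by (meson obtain_subset_with_card_n)
  then obtain x y where xy: "B = {x, y}" "x \<noteq> y"
    by (auto simp: card_2_iff)
  have eqs: "insert x A \<union> insert y A = insert x (insert y A)" "insert x A \<inter> insert y A = A"
    using B xy by auto
  have cards: "card (insert x A) = Suc i" "card (insert y A) = Suc i"
    "card (insert x (insert y A)) = Suc (Suc i)"
    using A B xy by auto
  have "rank_on G (insert x (insert y A)) + rank_on G A
      \<le> rank_on G (insert x A) + rank_on G (insert y A)"
    using rank_on_submodular[of G "insert x A" "insert y A"] eqs by simp
  moreover have "insert x A \<subseteq> T" "insert y A \<subseteq> T" "insert x (insert y A) \<subseteq> T"
    using A B xy by auto
  ultimately show ?thesis
    using A ura_on_rank[OF ura] cards i j by (simp add: leading_sum_Suc)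
qed

lemma ura_on_profile_decreasing:
  assumes "ura_on G T a" "1 \<le> i" "i \<le> j" "j \<le> card T"
  shows "a j \<le> a i"
  using assms(3,4)
proof (induction j rule: dec_induct)
  case (step j)
  then show ?case
    using ura_on_profile_step[OF assms(1), of j] assms(2) by simp
qed simp

text \<open>Distance at least 2 means that deleting one thick column preserves the rank.\<close>

lemma ura_on_last_zero:
  assumes C: "C = range (encode G)" and ura: "ura_on G T a"
    and d: "min_dist (puncture T C) \<ge> 2" and T: "T \<noteq> {}"
  shows "a (card T) = 0"
proof -
  obtain x where x: "x \<in> T"
    using T by auto
  obtain k where k: "card T = Suc k"
    using T by (cases "card T") auto
  have "T - (T - {x}) = {x}"
    using x by auto
  then have "rank_on G (T - {x}) = rank_on G T"
    using d by (intro rank_on_eq_if_min_dist_puncture[OF C]) auto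
  moreover have "card (T - {x}) = k"
    using x k by simp
  ultimately have "leading_sum a (card T) k = leading_sum a (card T) (card T)"
    using ura_on_rank[OF ura, of "T - {x}"] ura_on_rank[OF ura, of T] by simp
  then show ?thesis
    by (simp add: k leading_sum_Suc)
qed

section \<open>The structure theorem\<close>

text \<open>The remainder \<open>v\<close> ranges over \<open>{1..KL}\<close> instead of
  \<open>{0..<KL}\<close>, which matches the ceiling minus one.\<close>

lemma quotient_of_rank:
  assumes "K = q * KL + v" "0 < v" "v \<le> KL" "int u = \<lceil>real K / real KL\<rceil> - 1"
  shows "u = q"
proof -
  have "\<lceil>real K / real KL\<rceil> = int q + 1"
    using assms(1-3) by (intro ceiling_unique) (simp_all add: field_simps flip: of_nat_mult of_nat_add)
  then show ?thesis
    using assms(4) by simp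
qed

(* In (a)(i) and (b)(i) the degenerate case K = K_L (that is, u1 = 0) is excluded: there the claim
   fails, e.g. for the binary repetition code of length 3 with local supports {1,2} and {2,3}. *)

theorem theoremV4:
  fixes C :: "(('a::{field,finite}) ^ 'b ^ 'n) set"
    and G :: "'a ^ ('n::finite \<times> 'b::finite) ^ 'k::finite"
    and n K d \<alpha> \<kappa> r \<delta> nL KL u1 :: nat
    and L :: "'l set" and S :: "'l \<Rightarrow> 'n set"
    and a P Pinv :: "nat \<Rightarrow> nat"
    and V :: "'l \<Rightarrow> ('a ^ 'k) set"
  assumes code: "vector_code C G n K d \<alpha> \<kappa>"
    and cls: "class_U C G r \<delta> L S a"
    and nL: "nL = r + \<delta> - 1"
    and KL: "KL = (\<Sum>i=1..nL. a i)"
    and P: "P = leading_sum a nL"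
    and Pinv: "Pinv = leading_sum_inv a nL"
    and V: "\<And>i. V i = col_space G (S i)"
    and distance_optimal: "int d = int n - int (Pinv K) + 1"
    and rate_optimal: "K = P (n - d + 1)"
    and u1: "int u1 = \<lceil>real K / real KL\<rceil> - 1"
  shows
    "(strictly_subadditive P nL \<longrightarrow>
        (KL < K \<longrightarrow> (\<forall>i\<in>L. \<forall>j\<in>L. i \<noteq> j \<longrightarrow> S i \<inter> S j = {})) \<and>
        (\<forall>idx. inj_on idx {1..u1+1} \<and> idx ` {1..u1+1} \<subseteq> L \<longrightarrow>
           (\<forall>l\<in>{1..u1}. V (idx l) \<inter> (\<Sum>j\<in>{1..u1} - {l}. V (idx j)) = {0}) \<and>
           (\<forall>l\<in>{1..u1+1}. \<not> V (idx l) \<subseteq> (\<Sum>j\<in>{1..u1+1} - {l}. V (idx j)))))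
     \<and>
     (KL dvd K \<longrightarrow>
        (KL < K \<longrightarrow> (\<forall>i\<in>L. \<forall>j\<in>L. i \<noteq> j \<longrightarrow> S i \<inter> S j = {})) \<and>
        (\<forall>idx. inj_on idx {1..u1+1} \<and> idx ` {1..u1+1} \<subseteq> L \<longrightarrow>
           (\<forall>l\<in>{1..u1+1}. V (idx l) \<inter> (\<Sum>j\<in>{1..u1+1} - {l}. V (idx j)) = {0})))"
proof -
  have C: "C = range (encode G)"
    using code by (simp add: vector_code_def generator_matrix_def)
  have "K = vcode.dim C" "vcode.dim C = CARD('k)" and n: "n = CARD('n)" and d: "d = min_dist C"
    using code unfolding vector_code_def generator_matrix_def by argo+
  then have K: "K = CARD('k)"
    by simp
  have \<delta>: "\<delta> \<ge> 2" and inj: "inj_on S L" and spanning: "rank_on G (\<Union>l\<in>L. S l) = K"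
    using cls by (simp_all add: class_U_def exact_information_locality_def K)
  have card_S: "card (S l) = nL" and dist_S: "min_dist (puncture (S l) C) \<ge> 2"
    and ura_S: "ura_on G (S l) a" if "l \<in> L" for l
    using cls that \<delta> by (simp_all add: class_U_def exact_information_locality_def nL)
  have nL_pos: "nL \<ge> 1"
    using \<delta> nL by simp
  have K_pos: "K > 0"
    by (simp add: K)
  then have "L \<noteq> {}"
    using spanning by auto
  then obtain l0 where l0: "l0 \<in> L"
    by auto
  then have l0_ne: "S l0 \<noteq> {}"
    using card_S nL_pos by fastforce
  have decreasing: "a j \<le> a i" if "1 \<le> i" "i \<le> j" "j \<le> nL" for i j
    using ura_on_profile_decreasing[OF ura_S[OF l0]] that card_S[OF l0] by simp
  have last_zero: "a nL = 0"
    using ura_on_last_zero[OF C ura_S[OF l0] dist_S[OF l0] l0_ne] card_S[OF l0] by simp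

  define m where "m = Pinv K"
  have m_least: "m = (LEAST s. K \<le> P s)"
    by (simp add: m_def Pinv leading_sum_inv_def P)
  \<comment> \<open>Rate optimality provides the witness \<open>n - d + 1\<close> that the
    \<open>LEAST\<close> operator requires.\<close>
  have "K \<le> P m"
    unfolding m_least by (rule LeastI[of _ "n - d + 1"]) (rule eq_refl[OF rate_optimal])
  then have "m \<noteq> 0"
    using K_pos by (intro notI) (simp add: P)
  then obtain k where k: "m = Suc k"
    by (cases m) auto
  \<comment> \<open>As \<open>m\<close> is positive, \<open>d \<le> n\<close>, so the subtraction on
    \<open>nat\<close> is not truncated.\<close>
  have m_eq: "n - d + 1 = m"
    using distance_optimal k by (simp add: m_def)
  have P_m: "P m = K"
    using rate_optimal m_eq by simp
  have "P k < K"
    using not_less_Least[of k "\<lambda>s. K \<le> P s"] m_least k by simp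
  \<comment> \<open>Dividing \<open>k = m - 1\<close> puts the residue \<open>t\<close> of
    \<open>m\<close> into \<open>{1..nL}\<close>. Minimality of \<open>m\<close> then makes
    \<open>a t\<close>, the increment of \<open>P\<close> from \<open>k\<close> to \<open>m\<close>,
    positive.\<close>
  define q t where "q = k div nL" and "t = k mod nL + 1"
  have t: "1 \<le> t" "t \<le> nL"
    using nL_pos by (simp_all add: t_def Suc_le_eq)
  have m: "m = q * nL + t"
    by (simp add: k q_def t_def)
  have jump: "a t > 0"
    using \<open>P k < K\<close> P_m by (simp add: k P leading_sum_Suc t_def)
  have KL_eq: "KL = P nL"
    by (simp add: KL P leading_sum_eq_sum)
  have a1: "a 1 > 0"
    using decreasing[of 1 t] t jump by simp
  have P_pos: "P s > 0" if "1 \<le> s" for s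
    using leading_sum_mono[OF that, of a nL] a1 by (simp add: P leading_sum_Suc[of _ _ 0, simplified])
  have K_eq: "K = q * KL + P t"
    using P_m leading_sum_add_periods[of a nL q t] by (simp add: m KL_eq P)
  have Pt: "0 < P t" "P t \<le> KL"
    using P_pos[OF t(1)] leading_sum_mono[OF t(2)] by (simp_all add: KL_eq P)
  have u1_eq: "u1 = q"
    using quotient_of_rank[OF K_eq Pt u1] .

  have rank_UNIV: "rank_on G UNIV = K"
    using rank_on_mono[of "\<Union>l\<in>L. S l" UNIV G] rank_on_le_CARD[of G UNIV] spanning K by simp
  \<comment> \<open>Such a \<open>U\<close> misses at most \<open>n - m = d - 1\<close> thick
    columns.\<close>
  have full: "rank_on G U = K" if "m \<le> card U" for U
  proof -
    have "card (UNIV - U) + card U = n"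
      using card_mono[of UNIV U] by (simp add: card_Diff_subset n)
    then have "card (UNIV - U) < d"
      using distance_optimal that by (simp add: m_def)
    then show ?thesis
      using rank_on_eq_if_min_dist_puncture[OF C, of UNIV U] rank_UNIV d by simp
  qed

  \<comment> \<open>Strictness at \<open>t\<close> is the only input that (a) and (b) obtain in
    different ways.\<close>
  have family: "optimal_family a nL t (rank_on G) L S u1"
    if "\<And>c. \<lbrakk>1 \<le> c; c + t \<le> nL\<rbrakk> \<Longrightarrow> P (c + t) < P c + P t"
  proof unfold_locales
    show "rank_on G U = leading_sum a nL (card U)" if "l \<in> L" "U \<subseteq> S l" for l U
      using ura_on_rank[OF ura_S that(2)] that card_S by simp
    show "rank_on G U = leading_sum a nL (u1 * nL + t)" if "u1 * nL + t \<le> card U" for U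
      using full[of U] that P_m by (simp add: u1_eq m P)
    show "rank_on G (\<Union>l\<in>L. S l) = leading_sum a nL (u1 * nL + t)"
      using spanning P_m by (simp add: u1_eq m P)
    show "leading_sum a nL (c + t) < leading_sum a nL c + leading_sum a nL t"
      if "1 \<le> c" "c + t \<le> nL" for c
      using \<open>\<And>c. \<lbrakk>1 \<le> c; c + t \<le> nL\<rbrakk> \<Longrightarrow> P (c + t) < P c + P t\<close>[OF that] by (simp add: P)
  qed (use nL_pos decreasing last_zero t jump inj card_S rank_on_submodular in auto)

  have sum_V: "(\<Sum>j\<in>A. V (idx j)) = col_space G (\<Union>i\<in>idx ` A. S i)" if "finite A" for A idx
    using sum_col_space[OF that, of G "\<lambda>j. S (idx j)"] by (simp add: V)

  have disjoint: "\<forall>i\<in>L. \<forall>j\<in>L. i \<noteq> j \<longrightarrow> S i \<inter> S j = {}"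
    if fam: "optimal_family a nL t (rank_on G) L S u1" and "KL < K"
  proof -
    \<comment> \<open>For \<open>u1 = 0\<close> the rank would be
      \<open>K = P t \<le> KL\<close>.\<close>
    have "u1 \<noteq> 0"
      using K_eq Pt(2) \<open>KL < K\<close> u1_eq by (intro notI) simp
    then show ?thesis
      using optimal_family.disjoint_supports[OF fam] by simp
  qed

  have image: "idx ` {1..u1+1} - {idx l} = idx ` ({1..u1+1} - {l})"
    if "inj_on idx {1..u1+1}" "l \<in> {1..u1+1}" for idx :: "nat \<Rightarrow> 'l" and l
    using inj_on_image_set_diff[OF that(1), of "{1..u1+1}" "{l}"] that(2) by simp
  have image2: "idx ` {1..u1+1} - {idx (u1+1)} - {idx l} = idx ` ({1..u1} - {l})"
    if "inj_on idx {1..u1+1}" "l \<in> {1..u1}" for idx :: "nat \<Rightarrow> 'l" and l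
  proof -
    have "idx ` {1..u1+1} - idx ` {u1+1, l} = idx ` ({1..u1+1} - {u1+1, l})"
      using inj_on_image_set_diff[OF that(1), of "{1..u1+1}" "{u1+1, l}"] that(2) by simp
    moreover have "{1..u1+1} - {u1+1, l} = {1..u1} - {l}"
      by auto
    moreover have "X - {idx (u1+1)} - {idx l} = X - idx ` {u1+1, l}" for X
      by auto
    ultimately show ?thesis
      by (simp only:)
  qed

  show ?thesis
  proof (intro conjI impI allI ballI)
    assume "strictly_subadditive P nL"
    then have fam: "optimal_family a nL t (rank_on G) L S u1"
      using t(1) by (intro family) (simp add: strictly_subadditive_def)
    show "S i \<inter> S j = {}" if "KL < K" "i \<in> L" "j \<in> L" "i \<noteq> j" for i j
      using disjoint[OF fam] that by blast
    fix idx :: "nat \<Rightarrow> 'l"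
    assume idx: "inj_on idx {1..u1+1} \<and> idx ` {1..u1+1} \<subseteq> L"
    then have J: "idx ` {1..u1+1} \<subseteq> L" "card (idx ` {1..u1+1}) = u1 + 1"
      by (simp_all add: card_image)
    show "V (idx l) \<inter> (\<Sum>j\<in>{1..u1} - {l}. V (idx j)) = {0}" if l: "l \<in> {1..u1}" for l
    proof -
      have "idx (u1+1) \<in> idx ` {1..u1+1}" "idx l \<in> idx ` {1..u1+1}"
        using l by auto
      moreover have "idx l \<noteq> idx (u1+1)"
        using inj_on_eq_iff[of idx "{1..u1+1}" l "u1+1"] idx l by simp
      \<comment> \<open>The first \<open>u1\<close> codes arise from the family of
        \<open>u1 + 1\<close> by removing the last one.\<close>
      ultimately have "V (idx l) \<inter> col_space G (\<Union>i\<in>idx ` ({1..u1} - {l}). S i) = {0}"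
        unfolding V image2[OF conjunct1[OF idx] l, symmetric]
        by (intro col_space_Int_trivial optimal_family.f_Union_remove2_additive[OF fam J])
      then show ?thesis
        by (simp only: sum_V[of "{1..u1} - {l}" idx] finite_Diff finite_atLeastAtMost)
    qed
    show "\<not> V (idx l) \<subseteq> (\<Sum>j\<in>{1..u1+1} - {l}. V (idx j))" if l: "l \<in> {1..u1+1}" for l
    proof -
      have "\<not> V (idx l) \<subseteq> col_space G (\<Union>i\<in>idx ` ({1..u1+1} - {l}). S i)"
        unfolding V image[OF conjunct1[OF idx] l, symmetric]
        by (intro col_space_not_subset optimal_family.f_Union_remove_less[OF fam J] imageI l)
      then show ?thesis
        by (simp only: sum_V[of "{1..u1+1} - {l}" idx] finite_Diff finite_atLeastAtMost not_False_eq_True)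
    qed
  next
    assume "KL dvd K"
    then have "KL dvd P t"
      using K_eq by (simp add: dvd_add_right_iff)
    \<comment> \<open>The only multiple of \<open>KL\<close> with \<open>0 < P t \<le> KL\<close> is
      \<open>KL\<close> itself. Hence \<open>P (c + t) \<le> KL = P t\<close>, and strictness at
      \<open>t\<close> follows from \<open>P c > 0\<close>.\<close>
    then have PtKL: "P t = KL"
      using Pt by (simp add: dvd_imp_le le_antisym)
    have "P (c + t) < P c + P t" if "1 \<le> c" "c + t \<le> nL" for c
      using leading_sum_mono[OF that(2), of a nL] P_pos[OF that(1)] PtKL by (simp add: P KL_eq)
    then have fam: "optimal_family a nL t (rank_on G) L S u1"
      by (rule family)
    show "S i \<inter> S j = {}" if "KL < K" "i \<in> L" "j \<in> L" "i \<noteq> j" for i j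
      using disjoint[OF fam] that by blast
    fix idx :: "nat \<Rightarrow> 'l" and l
    assume idx: "inj_on idx {1..u1+1} \<and> idx ` {1..u1+1} \<subseteq> L" and l: "l \<in> {1..u1+1}"
    then have J: "idx ` {1..u1+1} \<subseteq> L" "card (idx ` {1..u1+1}) = u1 + 1"
      by (simp_all add: card_image)
    have Pt_eq: "leading_sum a nL t = leading_sum a nL nL"
      using PtKL by (simp add: P KL_eq)
    have "V (idx l) \<inter> col_space G (\<Union>i\<in>idx ` ({1..u1+1} - {l}). S i) = {0}"
      unfolding V image[OF conjunct1[OF idx] l, symmetric]
      by (intro col_space_Int_trivial optimal_family.f_Union_remove_additive[OF fam J] imageI l Pt_eq)
    then show "V (idx l) \<inter> (\<Sum>j\<in>{1..u1+1} - {l}. V (idx j)) = {0}"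
      by (simp only: sum_V[of "{1..u1+1} - {l}" idx] finite_Diff finite_atLeastAtMost)
  qed
qed

end
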